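(* For all positive integers $n, k$, we have $d(nk-1) \geq d(n-1)$.
   Context: For a finite simple graph $G=(V,E)$ and $v \in V$, let $N[v]$ be the closed neighborhood of $v$. Define the map $\Phi_G$ on subsets of $V$ by $\Phi_G(S) = \{v \in V : \lvert N[v]\cap S\rvert \text{ is odd}\}$; it is linear over $\mathbb{F}_2$ when subsets are identified with vectors in $\mathbb{F}_2^V$ (with symmetric difference as addition). For $m \geq 1$, $d(m)$ denotes $\dim_{\mathbb{F}_2} \ker \Phi_G$ where $G$ is the $m \times m$ grid graph (vertices are the cells of an $m\times m$ array, adjacent when they share a side); the empty $0\times 0$ grid has $d(0)=0$. *)

theory Defs
  imports
    "Graph_Theory.Pair_Digraph"
    "HOL-Library.Z2"
    "HOL-Library.Function_Algebras"
begin

text \<open>Finite simple graphs are symmetric loop-free pair digraphs (locale \<open>pair_graph\<close>).\<close>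

definition closed_nbhd :: "'a pair_pre_digraph \<Rightarrow> 'a \<Rightarrow> 'a set" where
  "closed_nbhd G v = insert v {u. (v, u) \<in> parcs G}"

definition Phi :: "'a pair_pre_digraph \<Rightarrow> 'a set \<Rightarrow> 'a set" where
  "Phi G S = {v \<in> pverts G. odd (card (closed_nbhd G v \<inter> S))}"

definition ker_Phi :: "'a pair_pre_digraph \<Rightarrow> 'a set set" where
  "ker_Phi G = {S. S \<subseteq> pverts G \<and> Phi G S = {}}"

text \<open>
  A vector in \<open>\<bbbF>\<^sub>2\<^sup>V\<close> is a function into the two-element field \<open>bit\<close> that vanishes outside \<open>V\<close>;
  a subset of \<open>V\<close> is identified with its characteristic vector.
\<close>

definition char_vec :: "'a set \<Rightarrow> 'a \<Rightarrow> bit" where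
  "char_vec S = (\<lambda>x. of_bool (x \<in> S))"

definition scale2 :: "bit \<Rightarrow> ('a \<Rightarrow> bit) \<Rightarrow> 'a \<Rightarrow> bit" where
  "scale2 c f = (\<lambda>x. c * f x)"

interpretation F2: vector_space scale2
  by unfold_locales (auto simp: scale2_def fun_eq_iff algebra_simps)

definition grid_graph :: "nat \<Rightarrow> (nat \<times> nat) pair_pre_digraph" where
  "grid_graph m = \<lparr> pverts = {1..m} \<times> {1..m},
     parcs = {((i, j), (i', j')). (i, j) \<in> {1..m} \<times> {1..m} \<and> (i', j') \<in> {1..m} \<times> {1..m} \<and>
       (i = i' \<and> (j' = j + 1 \<or> j = j' + 1) \<or> j = j' \<and> (i' = i + 1 \<or> i = i' + 1))} \<rparr>"

definition d :: "nat \<Rightarrow> nat" where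
  "d m = F2.dim (char_vec ` ker_Phi (grid_graph m))"

lemma pair_graph_grid_graph: "pair_graph (grid_graph m)"
proof -
  have "parcs (grid_graph m) \<subseteq> ({1..m} \<times> {1..m}) \<times> ({1..m} \<times> {1..m})"
    by (auto simp: grid_graph_def)
  then have "finite (parcs (grid_graph m))"
    by (rule finite_subset) auto
  then show ?thesis
    by unfold_locales (auto simp: grid_graph_def symmetric_def arcs_ends_def arc_to_ends_def intro!: symI)
qed

lemma char_vec_sym_diff: "char_vec (sym_diff S T) = char_vec S + char_vec T"
  by (auto simp: char_vec_def fun_eq_iff)

lemma Phi_sym_diff:
  assumes "finite S" "finite T"
  shows "Phi G (sym_diff S T) = sym_diff (Phi G S) (Phi G T)"
proof -
  have "odd (card (A \<inter> sym_diff S T)) \<longleftrightarrow> odd (card (A \<inter> S)) \<noteq> odd (card (A \<inter> T))" for A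
  proof -
    have S: "card (A \<inter> S) = card (A \<inter> (S - T)) + card (A \<inter> (S \<inter> T))"
      using assms by (subst card_Un_disjoint [symmetric]) (auto intro!: arg_cong[where f = card])
    have T: "card (A \<inter> T) = card (A \<inter> (T - S)) + card (A \<inter> (S \<inter> T))"
      using assms by (subst card_Un_disjoint [symmetric]) (auto intro!: arg_cong[where f = card])
    have "card (A \<inter> sym_diff S T) = card (A \<inter> (S - T)) + card (A \<inter> (T - S))"
      using assms by (subst card_Un_disjoint [symmetric]) (auto intro!: arg_cong[where f = card])
    with S T show ?thesis by auto
  qed
  then show ?thesis by (auto simp: Phi_def)
qed

lemma subspace_ker_Phi:
  assumes "finite (pverts G)"
  shows "F2.subspace (char_vec ` ker_Phi G)"
proof (rule F2.subspaceI)
  have 0: "{} \<in> ker_Phi G" by (auto simp: ker_Phi_def Phi_def)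
  have z: "char_vec {} = 0" by (auto simp: char_vec_def fun_eq_iff)
  show "0 \<in> char_vec ` ker_Phi G" using 0 z by (metis image_eqI)
  fix x y assume "x \<in> char_vec ` ker_Phi G" "y \<in> char_vec ` ker_Phi G"
  then obtain S T where ST: "x = char_vec S" "y = char_vec T" "S \<in> ker_Phi G" "T \<in> ker_Phi G"
    by auto
  then have fin: "finite S" "finite T" using assms by (auto simp: ker_Phi_def finite_subset)
  have "sym_diff S T \<in> ker_Phi G"
    using ST Phi_sym_diff[OF fin, of G] by (auto simp: ker_Phi_def)
  then show "x + y \<in> char_vec ` ker_Phi G"
    using ST by (metis char_vec_sym_diff image_eqI)
next
  have 0: "{} \<in> ker_Phi G" by (auto simp: ker_Phi_def Phi_def)
  fix c x assume x: "x \<in> char_vec ` ker_Phi G"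
  show "scale2 c x \<in> char_vec ` ker_Phi G"
  proof (cases c)
    case zero
    then have "scale2 c x = char_vec {}" by (simp add: scale2_def char_vec_def fun_eq_iff)
    then show ?thesis using 0 by blast
  next
    case one
    then show ?thesis using x by (simp only: F2.scale_one)
  qed
qed

lemma d_0: "d 0 = 0"
proof -
  have "char_vec ` ker_Phi (grid_graph 0) = {0}"
    by (auto simp: ker_Phi_def Phi_def grid_graph_def char_vec_def fun_eq_iff)
  then have "d 0 = F2.dim {0 :: nat \<times> nat \<Rightarrow> bit}" by (simp add: d_def)
  also have "\<dots> = card ({} :: (nat \<times> nat \<Rightarrow> bit) set)"
    by (rule F2.dim_eq_card) (simp_all add: F2.independent_empty F2.span_insert_0)
  finally show ?thesis by simp
qed

end

theory Submission
  imports Defs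
begin

text \<open>
  Unfold a kernel vector of the \<open>(n - 1) \<times> (n - 1)\<close> grid across the lines whose index is a multiple
  of \<open>n\<close> by repeated reflection, putting 0 on those lines. Off the lines, a cell sees a mirror image
  of a neighbourhood in the small grid; on a line, the two neighbours across it are mirror images and
  cancel modulo 2. Restricting to \<open>{1..n * k - 1}\<^sup>2\<close> cuts along such lines, so this gives an
  injective linear map between the kernels.
\<close>

lemma (in vector_space_pair) linear_inj_on_imp_dim_le:
  assumes lin: "Vector_Spaces.linear s1 s2 f"
    and inj: "inj_on f (vs1.span V)"
    and img: "f ` V \<subseteq> vs2.span W"
    and fin: "finite W"
  shows "vs1.dim V \<le> vs2.dim W"
proof -
  obtain B where B: "B \<subseteq> V" "vs1.independent B" "card B = vs1.dim V"
    using vs1.basis_exists [of V] by metis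
  obtain C where C: "C \<subseteq> W" "W \<subseteq> vs2.span C" "card C = vs2.dim W"
    using vs2.basis_exists [of W] by metis
  have inj_B: "inj_on f (vs1.span B)"
    using inj vs1.span_mono [OF B(1)] by (rule inj_on_subset)
  have "vs2.independent (f ` B)"
    using lin B(2) inj_B by (rule linear_independent_injective_image)
  moreover have "f ` B \<subseteq> vs2.span C"
    using B(1) img vs2.span_minimal [OF C(2) vs2.subspace_span] by blast
  moreover have "finite C"
    using C(1) fin by (rule finite_subset)
  ultimately have "card (f ` B) \<le> card C"
    using vs2.independent_span_bound by blast
  moreover have "card (f ` B) = card B"
    using inj_on_subset [OF inj_B vs1.span_superset] by (rule card_image)
  ultimately show ?thesis
    using B(3) C(3) by simp
qed

definition zero_outside :: "'a set \<Rightarrow> ('a \<Rightarrow> 'b::zero) \<Rightarrow> 'a \<Rightarrow> 'b" where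
  "zero_outside A f = (\<lambda>x. if x \<in> A then f x else 0)"

lemma linear_zero_outside_comp:
  "Vector_Spaces.linear scale2 scale2 (\<lambda>f. zero_outside A (f \<circ> \<phi>))"
  by unfold_locales (auto simp: zero_outside_def scale2_def fun_eq_iff)

lemma inj_on_zero_outside_comp:
  assumes "B \<subseteq> \<phi> ` A"
  shows "inj_on (\<lambda>f. zero_outside A (f \<circ> \<phi>)) {f. \<forall>y. y \<notin> B \<longrightarrow> f y = 0}"
proof (rule inj_onI, rule ext)
  fix f g y
  assume f: "f \<in> {f. \<forall>y. y \<notin> B \<longrightarrow> f y = 0}" and g: "g \<in> {f. \<forall>y. y \<notin> B \<longrightarrow> f y = 0}"
    and eq: "zero_outside A (f \<circ> \<phi>) = zero_outside A (g \<circ> \<phi>)"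
  show "f y = g y"
  proof (cases "y \<in> B")
    case True
    then obtain x where "x \<in> A" "y = \<phi> x"
      using assms by blast
    then show ?thesis
      using fun_cong [OF eq, of x] by (simp add: zero_outside_def)
  next
    case False
    then show ?thesis
      using f g by simp
  qed
qed

abbreviation ker_vecs :: "'a pair_pre_digraph \<Rightarrow> ('a \<Rightarrow> bit) set" where
  "ker_vecs G \<equiv> char_vec ` ker_Phi G"

lemma finite_ker_vecs: "finite (pverts G) \<Longrightarrow> finite (ker_vecs G)"
  by (rule finite_imageI, rule finite_subset [of _ "Pow (pverts G)"]) (auto simp: ker_Phi_def)

lemma char_vec_eq_0_iff: "char_vec S x = 0 \<longleftrightarrow> x \<notin> S"
  by (simp add: char_vec_def)

lemma char_vec_support: "char_vec {x. g x \<noteq> 0} = g"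
  by (auto simp: char_vec_def fun_eq_iff)

lemma sum_char_vec_eq_0_iff:
  assumes "finite A"
  shows "(\<Sum>x\<in>A. char_vec S x) = 0 \<longleftrightarrow> even (card (A \<inter> S))"
proof -
  have "of_nat c = (0 :: bit) \<longleftrightarrow> even c" for c
    by (induction c) auto
  then show ?thesis
    using assms by (simp add: char_vec_def)
qed

lemma mem_ker_vecs_iff:
  assumes "finite (parcs G)"
  shows "g \<in> ker_vecs G \<longleftrightarrow>
    (\<forall>v. v \<notin> pverts G \<longrightarrow> g v = 0) \<and> (\<forall>v\<in>pverts G. (\<Sum>u\<in>closed_nbhd G v. g u) = 0)"
    (is "_ \<longleftrightarrow> ?in_ker g")
proof -
  have "closed_nbhd G v = insert v (parcs G `` {v})" for v
    by (auto simp: closed_nbhd_def)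
  then have fin: "finite (closed_nbhd G v)" for v
    using assms by (simp add: finite_Image)
  have mem_ker_Phi: "S \<in> ker_Phi G \<longleftrightarrow> ?in_ker (char_vec S)" for S
    unfolding sum_char_vec_eq_0_iff [OF fin] char_vec_eq_0_iff ker_Phi_def Phi_def by blast
  show ?thesis
  proof
    assume "g \<in> ker_vecs G"
    then show "?in_ker g"
      using mem_ker_Phi by blast
  next
    assume "?in_ker g"
    then have "{v. g v \<noteq> 0} \<in> ker_Phi G"
      unfolding mem_ker_Phi char_vec_support .
    then show "g \<in> ker_vecs G"
      by (metis char_vec_support image_eqI)
  qed
qed

text \<open>Meant for positive \<open>i\<close> and \<open>j\<close> only: truncated subtraction collapses the cross at index 0.\<close>

definition cross_sum :: "(nat \<times> nat \<Rightarrow> 'a::comm_monoid_add) \<Rightarrow> nat \<Rightarrow> nat \<Rightarrow> 'a" where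
  "cross_sum g i j = g (i, j) + (g (i - 1, j) + g (i + 1, j)) + (g (i, j - 1) + g (i, j + 1))"

lemma sum_closed_nbhd_grid_graph:
  assumes supp: "\<And>p. p \<notin> {1..m} \<times> {1..m} \<Longrightarrow> g p = 0"
    and "i \<in> {1..m}" "j \<in> {1..m}"
  shows "(\<Sum>p\<in>closed_nbhd (grid_graph m) (i, j). g p) = cross_sum g i j"
proof -
  let ?cross = "{(i, j), (i - 1, j), (i + 1, j), (i, j - 1), (i, j + 1)}"
  have "closed_nbhd (grid_graph m) (i, j) = ?cross \<inter> {1..m} \<times> {1..m}"
    using assms(2,3) by (auto simp: closed_nbhd_def grid_graph_def)
  then have "(\<Sum>p\<in>closed_nbhd (grid_graph m) (i, j). g p) = (\<Sum>p\<in>?cross. g p)"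
    using supp by (intro sum.mono_neutral_left) auto
  also have "\<dots> = cross_sum g i j"
    using assms(2,3) by (cases i; cases j) (auto simp: cross_sum_def add.assoc)
  finally show ?thesis .
qed

lemma mem_ker_vecs_grid_graph_iff:
  "g \<in> ker_vecs (grid_graph m) \<longleftrightarrow>
    (\<forall>p. p \<notin> {1..m} \<times> {1..m} \<longrightarrow> g p = 0) \<and> (\<forall>i\<in>{1..m}. \<forall>j\<in>{1..m}. cross_sum g i j = 0)"
proof -
  interpret pair_graph "grid_graph m"
    by (rule pair_graph_grid_graph)
  have verts: "pverts (grid_graph m) = {1..m} \<times> {1..m}"
    by (simp add: grid_graph_def)
  have "(\<Sum>p\<in>closed_nbhd (grid_graph m) (i, j). g p) = cross_sum g i j"
    if "\<forall>p. p \<notin> {1..m} \<times> {1..m} \<longrightarrow> g p = 0" "i \<in> {1..m}" "j \<in> {1..m}" for i j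
    by (rule sum_closed_nbhd_grid_graph) (use that in blast)+
  then show ?thesis
    unfolding mem_ker_vecs_iff [OF pair_finite_arcs] verts by auto
qed

lemma zero_outside_mem_ker_vecs_grid_graph:
  assumes boundary: "\<And>i j. i \<in> {0, Suc m} \<or> j \<in> {0, Suc m} \<Longrightarrow> g (i, j) = 0"
    and cross: "\<And>i j. i \<in> {1..m} \<Longrightarrow> j \<in> {1..m} \<Longrightarrow> cross_sum g i j = 0"
  shows "zero_outside ({1..m} \<times> {1..m}) g \<in> ker_vecs (grid_graph m)"
proof -
  define g' where "g' = zero_outside ({1..m} \<times> {1..m}) g"
  have "g' (i, j) = g (i, j)" if "i \<le> Suc m" "j \<le> Suc m" for i j
    using that boundary [of i j] by (auto simp: g'_def zero_outside_def not_less_eq_eq)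
  then have "cross_sum g' i j = cross_sum g i j" if "i \<in> {1..m}" "j \<in> {1..m}" for i j
    using that by (cases i; cases j) (simp_all add: cross_sum_def)
  then have "cross_sum g' i j = 0" if "i \<in> {1..m}" "j \<in> {1..m}" for i j
    using that cross by simp
  moreover have "g' p = 0" if "p \<notin> {1..m} \<times> {1..m}" for p
    unfolding g'_def zero_outside_def using that by (rule if_not_P)
  ultimately show ?thesis
    unfolding mem_ker_vecs_grid_graph_iff g'_def by blast
qed

definition fold_coord :: "nat \<Rightarrow> nat \<Rightarrow> nat" where
  "fold_coord n i = (if even (i div n) then i mod n else n - i mod n)"

lemma fold_coord_id: "i < n \<Longrightarrow> fold_coord n i = i"
  by (simp add: fold_coord_def)

lemma fold_coord_mult_add:
  assumes "r \<le> n"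
  shows "fold_coord n (n * q + r) = (if even q then r else n - r)"
proof (cases "r < n")
  case True
  then show ?thesis
    by (simp add: fold_coord_def)
next
  case False
  then have "n * q + r = n * Suc q"
    using assms by simp
  with False assms show ?thesis
    by (cases "n = 0") (simp_all add: fold_coord_def del: mult_Suc_right)
qed

lemma fold_coord_le: "n > 0 \<Longrightarrow> fold_coord n i \<le> n"
  by (simp add: fold_coord_def less_imp_le)

lemma fold_coord_on_line_iff:
  assumes "n > 0"
  shows "fold_coord n i \<in> {0, n} \<longleftrightarrow> n dvd i"
proof -
  define r where "r = i mod n"
  then have "r < n"
    using assms by simp
  then have "fold_coord n i \<in> {0, n} \<longleftrightarrow> r = 0"
    by (auto simp: fold_coord_def r_def [symmetric])
  then show ?thesis
    unfolding r_def dvd_eq_mod_eq_0 .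
qed

lemma fold_coord_reflect_line:
  assumes "n dvd i" "i > 0"
  shows "fold_coord n (i - 1) = fold_coord n (i + 1)"
proof -
  from assms obtain q where i: "i = n * Suc q" and "n > 0"
    by (metis dvd_def gr0_conv_Suc mult_eq_0_iff not_gr0)
  then have "i - 1 = n * q + (n - 1)"
    by simp
  then have "fold_coord n (i - 1) = (if even q then n - 1 else 1)"
    using \<open>n > 0\<close> by (simp only: fold_coord_mult_add [OF diff_le_self]) simp
  moreover have "fold_coord n (i + 1) = (if even q then n - 1 else 1)"
    using \<open>n > 0\<close> fold_coord_mult_add [of 1 n "Suc q"] by (simp add: i)
  ultimately show ?thesis
    by simp
qed

lemma sum_fold_coord_neighbours:
  fixes h :: "nat \<Rightarrow> 'a::ab_semigroup_add"
  assumes "n > 0" "\<not> n dvd i"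
  shows "h (fold_coord n (i - 1)) + h (fold_coord n (i + 1)) =
    h (fold_coord n i - 1) + h (fold_coord n i + 1)"
proof -
  define q r where "q = i div n" and "r = i mod n"
  then have i: "i = n * q + r" and r: "0 < r" "r < n"
    using assms by (simp_all add: mod_greater_zero_iff_not_dvd)
  then have "i - 1 = n * q + (r - 1)" "i + 1 = n * q + (r + 1)"
    by simp_all
  then have "fold_coord n (i - 1) = (if even q then r - 1 else n - (r - 1))"
    "fold_coord n (i + 1) = (if even q then r + 1 else n - (r + 1))"
    "fold_coord n i = (if even q then r else n - r)"
    using r i by (simp_all only: fold_coord_mult_add)
  moreover have "n - (r - 1) = n - r + 1" "n - (r + 1) = n - r - 1"
    using r by simp_all
  ultimately show ?thesis
    by (simp add: add.commute)
qed

abbreviation fold_plane :: "nat \<Rightarrow> nat \<times> nat \<Rightarrow> nat \<times> nat" where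
  "fold_plane n \<equiv> map_prod (fold_coord n) (fold_coord n)"

lemma cross_sum_fold_plane_off_lines:
  assumes "n > 0" "\<not> n dvd i" "\<not> n dvd j"
  shows "cross_sum (f \<circ> fold_plane n) i j = cross_sum f (fold_coord n i) (fold_coord n j)"
  using sum_fold_coord_neighbours [OF assms(1,2), of "\<lambda>a. f (a, fold_coord n j)"]
    sum_fold_coord_neighbours [OF assms(1,3), of "\<lambda>b. f (fold_coord n i, b)"]
  by (simp only: cross_sum_def comp_apply map_prod_simp)

lemma cross_sum_fold_plane_on_lines:
  fixes f :: "nat \<times> nat \<Rightarrow> bit"
  assumes "i > 0" "j > 0" "n dvd i \<or> n dvd j"
    and lines: "\<And>a b. n dvd a \<or> n dvd b \<Longrightarrow> f (fold_coord n a, fold_coord n b) = 0"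
  shows "cross_sum (f \<circ> fold_plane n) i j = 0"
  using assms(3)
proof
  assume "n dvd i"
  then show ?thesis
    using fold_coord_reflect_line [OF _ \<open>i > 0\<close>] by (simp add: cross_sum_def lines)
next
  assume "n dvd j"
  then show ?thesis
    using fold_coord_reflect_line [OF _ \<open>j > 0\<close>] by (simp add: cross_sum_def lines)
qed

abbreviation unfold_vec :: "nat \<Rightarrow> nat \<Rightarrow> (nat \<times> nat \<Rightarrow> bit) \<Rightarrow> nat \<times> nat \<Rightarrow> bit" where
  "unfold_vec l m f \<equiv> zero_outside ({1..m} \<times> {1..m}) (f \<circ> fold_plane (Suc l))"

lemma unfold_vec_mem_ker_vecs:
  assumes Suc_dvd: "Suc l dvd Suc m" and f: "f \<in> ker_vecs (grid_graph l)"
  shows "unfold_vec l m f \<in> ker_vecs (grid_graph m)"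
proof (rule zero_outside_mem_ker_vecs_grid_graph)
  let ?c = "fold_coord (Suc l)"
  have supp: "f p = 0" if "p \<notin> {1..l} \<times> {1..l}" for p
    using f that unfolding mem_ker_vecs_grid_graph_iff by blast
  have fold_off_line: "?c a \<in> {1..l} \<longleftrightarrow> \<not> Suc l dvd a" for a
    using fold_coord_le [of "Suc l" a] fold_coord_on_line_iff [of "Suc l" a] by auto
  have lines: "f (?c a, ?c b) = 0" if "Suc l dvd a \<or> Suc l dvd b" for a b
    using that fold_off_line by (intro supp) blast
  fix i j
  show "(f \<circ> fold_plane (Suc l)) (i, j) = 0" if "i \<in> {0, Suc m} \<or> j \<in> {0, Suc m}"
  proof -
    have "Suc l dvd i \<or> Suc l dvd j"
      using that Suc_dvd by auto
    then show ?thesis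
      by (simp add: lines)
  qed
  assume ij: "i \<in> {1..m}" "j \<in> {1..m}"
  show "cross_sum (f \<circ> fold_plane (Suc l)) i j = 0"
  proof (cases "Suc l dvd i \<or> Suc l dvd j")
    case True
    then show ?thesis
      using ij lines by (intro cross_sum_fold_plane_on_lines) auto
  next
    case False
    then have "cross_sum f (?c i) (?c j) = 0"
      using f fold_off_line unfolding mem_ker_vecs_grid_graph_iff by blast
    then show ?thesis
      using False by (simp add: cross_sum_fold_plane_off_lines)
  qed
qed

lemma inj_on_unfold_vec:
  assumes "l \<le> m"
  shows "inj_on (unfold_vec l m) (ker_vecs (grid_graph l))"
proof -
  have "{1..l} \<times> {1..l} \<subseteq> fold_plane (Suc l) ` ({1..m} \<times> {1..m})"
  proof
    fix p assume "p \<in> {1..l} \<times> {1..l}"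
    then have "p \<in> {1..m} \<times> {1..m}" "fold_plane (Suc l) p = p"
      using assms by (auto simp: fold_coord_id)
    then show "p \<in> fold_plane (Suc l) ` ({1..m} \<times> {1..m})"
      by (metis image_eqI)
  qed
  then show ?thesis
    by (rule inj_on_subset [OF inj_on_zero_outside_comp])
      (use mem_ker_vecs_grid_graph_iff in blast)
qed

lemma d_le_d_if_Suc_dvd_Suc:
  assumes "Suc l dvd Suc m"
  shows "d l \<le> d m"
proof -
  interpret vector_space_pair "scale2 :: bit \<Rightarrow> (nat \<times> nat \<Rightarrow> bit) \<Rightarrow> _"
    "scale2 :: bit \<Rightarrow> (nat \<times> nat \<Rightarrow> bit) \<Rightarrow> _"
    by unfold_locales
  have fin: "finite (pverts (grid_graph k))" for k
    by (simp add: grid_graph_def)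
  have "F2.span (ker_vecs (grid_graph l)) = ker_vecs (grid_graph l)"
    using subspace_ker_Phi [OF fin] by (simp only: F2.span_eq_iff)
  moreover have "l \<le> m"
    using dvd_imp_le [OF assms] by simp
  ultimately have inj: "inj_on (unfold_vec l m) (F2.span (ker_vecs (grid_graph l)))"
    by (simp only: inj_on_unfold_vec)
  have "unfold_vec l m ` ker_vecs (grid_graph l) \<subseteq> F2.span (ker_vecs (grid_graph m))"
    using unfold_vec_mem_ker_vecs [OF assms] F2.span_base by blast
  then show ?thesis
    unfolding d_def
    by (rule linear_inj_on_imp_dim_le [OF linear_zero_outside_comp inj])
      (rule finite_ker_vecs [OF fin])
qed

theorem theorem2:
  fixes n k :: nat
  assumes "n > 0" and "k > 0"
  shows "d (n * k - 1) \<ge> d (n - 1)"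
proof (rule d_le_d_if_Suc_dvd_Suc)
  show "Suc (n - 1) dvd Suc (n * k - 1)"
    using assms by simp
qed

end
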